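(* Let $m\ge1$. The normalized scaling limit pair correlation function of zeros in codimension $1$ on $m$-dimensional manifolds satisfies, for distinct $z^1,z^2\in\mathbb C^m$, $\widetilde K^\infty_{21m}(z^1,z^2)=\kappa_{1m}(|z^1-z^2|)$, where $$\kappa_{1m}(r)=\frac{\left[\frac12(m^2+m)\sinh^2t+t^2\right]\cosh t-(m+1)\,t\sinh t}{m^2\sinh^3t}+\frac{m-1}{2m},\qquad t=\frac{r^2}{2}.$$
   Context: The scaling limit pair correlation function is $K^\infty_{21m}(z^1,z^2)=\lim_{N\to\infty}N^{-2}K^N_{21}(z^1/\sqrt N,z^2/\sqrt N)$ for distinct $z^1,z^2\in\mathbb C^m$. Here $K^N_{21}$ is the density (with respect to product Riemannian volume on pairs of distinct points) of $\mathbf E(|Z_s|\times|Z_s|)$, where $|Z_s|$ is the Riemannian $(2m-2)$-volume measure on the zero set of a Gaussian random section $s$ of $L^N$ and $(L,h)\to M$ is a positive Hermitian line bundle over a compact $m$-dimensional complex manifold with Kähler form $\omega=\frac i2\Theta_h$, $\Theta_h=-\partial\bar\partial\log\|e_L\|_h^2$. The Gaussian measure on $H^0(M,L^N)$ is the standard one for the inner product $\int_Mh^N(s_1,s_2)\,\omega^m/m!$, and the coordinates are centered at a point $z^0$ with $\omega(z^0)=\frac i2\sum dz_q\wedge d\bar z_q$. The limit does not depend on $M,L,h,z^0$. Explicitly, $$K^\infty_{21m}(z^1,z^2)=\frac1{\pi^{2}\det A}\Big\langle\prod_{p=1}^2\sum_{q=1}^m|a^p_q|^2\Big\rangle_\Lambda,\qquad\Lambda=C-B^*A^{-1}B,$$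 where $\langle\cdot\rangle_\Lambda$ is expectation for the centered complex Gaussian vector $(a^p_q)_{p=1,2;\,1\le q\le m}$ with $\mathbf E(a^p_qa^{p'}_{q'})=0$ and $\mathbf E(a^p_q\overline{a^{p'}_{q'}})=\Lambda^{pq}_{p'q'}$. The matrices have entries $A^p_{p'}=e^{z^p\cdot\bar z^{p'}}$, $B^p_{p'q'}=z^p_{q'}e^{z^p\cdot\bar z^{p'}}$, $C^{pq}_{p'q'}=(\delta_{qq'}+\bar z^{p'}_qz^p_{q'})e^{z^p\cdot\bar z^{p'}}$ (unprimed indices for rows, primed for columns), with $z\cdot\bar w=\sum_qz_q\bar w_q$. Normalization: $\widetilde K^\infty_{21m}=(\pi/m)^2K^\infty_{21m}$ (division by the square of the constant one-point function $K^\infty_{11m}=m/\pi$). *)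

theory Defs
  imports "HOL-Probability.Probability"
begin

text \<open>
  The pair correlation is given by its explicit Gaussian form, which is independent of the
  manifold, the line bundle and the base point. The dimension is \<open>m = CARD('m)\<close>, and the two
  points are packed into a vector \<open>z\<close> with \<open>z $ 1 = z1\<close> and \<open>z $ 2 = z2\<close>.
\<close>

subsection \<open>Centered complex Gaussian vectors\<close>

text \<open>Degenerate (zero variance) Gaussians are admitted.\<close>

definition centered_real_gaussian :: "'a measure \<Rightarrow> ('a \<Rightarrow> real) \<Rightarrow> bool" where
  "centered_real_gaussian M X \<longleftrightarrow>
     X \<in> borel_measurable M \<and>
     ((AE x in M. X x = 0) \<or> (\<exists>\<sigma>>0. distributed M lborel X (normal_density 0 \<sigma>)))"

text \<open>
  The maps \<open>a \<mapsto> Re (\<Sum>i. c i * a i)\<close> are exactly the real-linear functionals on complex n-space, so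
  the second clause is joint Gaussianity of the real and imaginary parts of the coordinates.
\<close>

definition is_complex_gaussian_law ::
    "complex ^ 'n ^ 'n \<Rightarrow> (complex ^ 'n::finite) measure \<Rightarrow> bool" where
  "is_complex_gaussian_law \<Lambda> \<mu> \<longleftrightarrow>
     prob_space \<mu> \<and> sets \<mu> = sets borel \<and>
     (\<forall>c :: complex ^ 'n. centered_real_gaussian \<mu> (\<lambda>a. Re (\<Sum>i\<in>UNIV. c $ i * a $ i))) \<and>
     (\<forall>i j. (LINT a|\<mu>. a $ i * a $ j) = 0) \<and>
     (\<forall>i j. (LINT a|\<mu>. a $ i * cnj (a $ j)) = \<Lambda> $ i $ j)"

text \<open>A Gaussian law is determined by its covariances, so the choice is of a unique object.\<close>

definition complex_gaussian_law :: "complex ^ 'n ^ 'n \<Rightarrow> (complex ^ 'n::finite) measure" where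
  "complex_gaussian_law \<Lambda> = (SOME \<mu>. is_complex_gaussian_law \<Lambda> \<mu>)"

definition gaussian_expectation ::
    "complex ^ 'n ^ 'n \<Rightarrow> (complex ^ 'n::finite \<Rightarrow> real) \<Rightarrow> real" where
  "gaussian_expectation \<Lambda> f = (LINT a|complex_gaussian_law \<Lambda>. f a)"

subsection \<open>The limit covariance matrices\<close>

definition herm_dot :: "complex ^ 'm \<Rightarrow> complex ^ 'm::finite \<Rightarrow> complex" where
  "herm_dot z w = (\<Sum>q\<in>UNIV. z $ q * cnj (w $ q))"

definition conj_transpose :: "complex ^ 'n ^ 'k \<Rightarrow> complex ^ 'k ^ 'n" where
  "conj_transpose X = (\<chi> i j. cnj (X $ j $ i))"

definition matA :: "(complex ^ 'm::finite) ^ 2 \<Rightarrow> complex ^ 2 ^ 2" where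
  "matA z = (\<chi> p p'. exp (herm_dot (z $ p) (z $ p')))"

definition matB :: "(complex ^ 'm::finite) ^ 2 \<Rightarrow> complex ^ (2 \<times> 'm) ^ 2" where
  "matB z = (\<chi> p k. case k of (p', q') \<Rightarrow> z $ p $ q' * exp (herm_dot (z $ p) (z $ p')))"

definition matC :: "(complex ^ 'm::finite) ^ 2 \<Rightarrow> complex ^ (2 \<times> 'm) ^ (2 \<times> 'm)" where
  "matC z = (\<chi> j k. case (j, k) of ((p, q), (p', q')) \<Rightarrow>
     ((if q = q' then 1 else 0) + cnj (z $ p' $ q) * z $ p $ q') *
     exp (herm_dot (z $ p) (z $ p')))"

definition matLambda :: "(complex ^ 'm::finite) ^ 2 \<Rightarrow> complex ^ (2 \<times> 'm) ^ (2 \<times> 'm)" where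
  "matLambda z = matC z - conj_transpose (matB z) ** matrix_inv (matA z) ** matB z"

subsection \<open>Pair correlation functions\<close>

text \<open>
  Complex-valued because \<open>det A\<close> is formally a complex number.
\<close>

definition pair_correlation :: "complex ^ 'm \<Rightarrow> complex ^ 'm::finite \<Rightarrow> complex" where
  "pair_correlation z1 z2 =
     (let z = vector [z1, z2] :: (complex ^ 'm) ^ 2 in
        1 / (complex_of_real (pi\<^sup>2) * det (matA z)) *
        complex_of_real (gaussian_expectation (matLambda z)
          (\<lambda>a. \<Prod>p\<in>UNIV. \<Sum>q\<in>UNIV. (cmod (a $ (p, q)))\<^sup>2)))"

definition normalized_pair_correlation ::
    "complex ^ 'm \<Rightarrow> complex ^ 'm::finite \<Rightarrow> complex" where
  "normalized_pair_correlation z1 z2 =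
     complex_of_real ((pi / real CARD('m))\<^sup>2) * pair_correlation z1 z2"

definition kappa :: "nat \<Rightarrow> real \<Rightarrow> real" where
  "kappa m r =
     (let t = r\<^sup>2 / 2 in
        (((real m ^ 2 + real m) / 2 * (sinh t)\<^sup>2 + t\<^sup>2) * cosh t - (real m + 1) * t * sinh t)
          / (real m ^ 2 * (sinh t) ^ 3)
        + (real m - 1) / (2 * real m))"

end

theory Submission
  imports Defs
begin

text \<open>
  Put \<open>u = z1 - z2\<close>, \<open>r = |u|\<close> and \<open>v = 1 / (exp (r\<^sup>2) - 1)\<close>. The entry of the matrix \<open>\<Lambda>\<close> at
  \<open>(p, q), (p', q')\<close> is \<open>A\<^sub>p\<^sub>p\<^sub>'\<close> times the \<open>q, q'\<close> entry of \<open>1 - \<lambda> u\<^sup>* u\<close>, where \<open>\<lambda> = v\<close> for \<open>p = p'\<close> and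
  \<open>\<lambda> = 1 + v\<close> otherwise. Wick's formula turns the expectation into
  \<open>tr \<Lambda>\<^sub>1\<^sub>1 tr \<Lambda>\<^sub>2\<^sub>2 + |\<Lambda>\<^sub>1\<^sub>2|\<^sup>2\<close>, and dividing by \<open>det A = |A\<^sub>1\<^sub>2|\<^sup>2 (exp (r\<^sup>2) - 1)\<close> leaves a function of
  \<open>r\<close> alone. As the Gaussian law is given by a choice operator, its existence has to be shown too: with \<open>E\<close> the
  projection onto \<open>u\<close>, \<open>\<Lambda> = A \<otimes> (1 - E) + G \<otimes> E\<close> for a \<open>2 \<times> 2\<close> matrix \<open>G\<close> that is positive
  because \<open>sinh t \<ge> t\<close>.
\<close>

subsection \<open>Moments and existence of complex Gaussian laws\<close>

text \<open>A variable that vanishes almost everywhere has all these moments trivially; otherwise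
  \<open>X\<close> has a normal density and the two moments are \<open>\<sigma>^2\<close> and
  \<open>3 * \<sigma>^4\<close>.\<close>

lemma centered_real_gaussian_moments:
  assumes "prob_space M" and X: "centered_real_gaussian M X"
  shows centered_real_gaussian_integrable_power: "integrable M (\<lambda>x. X x ^ k)"
    and centered_real_gaussian_fourth_moment: "(LINT x|M. X x ^ 4) = 3 * (LINT x|M. X x ^ 2)\<^sup>2"
proof -
  interpret prob_space M by fact
  have [measurable]: "X \<in> borel_measurable M"
    using X by (simp add: centered_real_gaussian_def)
  consider (zero) "AE x in M. X x = 0"
    | (normal) \<sigma> where "\<sigma> > 0" "distributed M lborel X (normal_density 0 \<sigma>)"
    using X by (auto simp: centered_real_gaussian_def)
  then have "integrable M (\<lambda>x. X x ^ k) \<and> (LINT x|M. X x ^ 4) = 3 * (LINT x|M. X x ^ 2)\<^sup>2"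
  proof cases
    case zero
    then have ae: "AE x in M. X x ^ n = 0 ^ n" for n
      by auto
    have "integrable M (\<lambda>x. X x ^ k) \<longleftrightarrow> integrable M (\<lambda>x. 0 ^ k :: real)"
      using ae by (intro integrable_cong_AE) auto
    moreover have "(LINT x|M. X x ^ n) = (LINT x|M. 0 ^ n)" for n
      using ae by (intro integral_cong_AE) auto
    ultimately show ?thesis
      by simp
  next
    case normal
    have "(LINT x|M. X x ^ (2 * n)) = fact (2 * n) / ((2 / \<sigma>\<^sup>2) ^ n * fact n)" for n
      using distributed_integral[OF normal(2), of "\<lambda>x. x ^ (2 * n)"]
        integral_normal_moment_even[OF normal(1), of 0 n] by simp
    from this[of 1] this[of 2] normal(1)
    have "(LINT x|M. X x ^ 2) = \<sigma>\<^sup>2" "(LINT x|M. X x ^ 4) = 3 * \<sigma> ^ 4"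
      by (simp_all add: fact_numeral power2_eq_square power4_eq_xxxx)
    moreover have "integrable M (\<lambda>x. X x ^ k)"
      using distributed_integrable[OF normal(2), of "\<lambda>x. x ^ k"]
        integrable_normal_moment[OF normal(1), of 0 k] by simp
    ultimately show ?thesis
      by simp
  qed
  then show "integrable M (\<lambda>x. X x ^ k)" "(LINT x|M. X x ^ 4) = 3 * (LINT x|M. X x ^ 2)\<^sup>2"
    by auto
qed

text \<open>Joint Gaussianity enters only through the sum and the difference: by polarization,
  knowing that \<open>X\<close>, \<open>Y\<close>, \<open>X + Y\<close> and \<open>X - Y\<close> are
  each Gaussian determines the mixed fourth moment.\<close>

lemma centered_real_gaussian_wick:
  assumes M: "prob_space M"
    and X: "centered_real_gaussian M X" and Y: "centered_real_gaussian M Y"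
    and S: "centered_real_gaussian M (\<lambda>x. X x + Y x)"
    and D: "centered_real_gaussian M (\<lambda>x. X x - Y x)"
  shows centered_real_gaussian_integrable_mult: "integrable M (\<lambda>x. X x * Y x)"
    and centered_real_gaussian_integrable_squares: "integrable M (\<lambda>x. (X x)\<^sup>2 * (Y x)\<^sup>2)"
    and centered_real_gaussian_wick_squares: "(LINT x|M. (X x)\<^sup>2 * (Y x)\<^sup>2) =
      (LINT x|M. (X x)\<^sup>2) * (LINT x|M. (Y x)\<^sup>2) + 2 * (LINT x|M. X x * Y x)\<^sup>2"
proof -
  note [simp] = centered_real_gaussian_integrable_power[OF M X]
    centered_real_gaussian_integrable_power[OF M Y]
    centered_real_gaussian_integrable_power[OF M S]
    centered_real_gaussian_integrable_power[OF M D]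
  have mult: "X x * Y x = ((X x + Y x) ^ 2 - (X x - Y x) ^ 2) / 4" for x
    by (simp add: power2_eq_square field_simps)
  show XY [simp]: "integrable M (\<lambda>x. X x * Y x)"
    unfolding mult by simp
  \<comment> \<open>Polarization reduces the mixed moment to fourth moments of single Gaussian variables.\<close>
  have sq: "(X x)\<^sup>2 * (Y x)\<^sup>2 =
      ((X x + Y x) ^ 4 + (X x - Y x) ^ 4 - 2 * X x ^ 4 - 2 * Y x ^ 4) / 12" for x
    by (simp add: power2_eq_square power4_eq_xxxx field_simps)
  show "integrable M (\<lambda>x. (X x)\<^sup>2 * (Y x)\<^sup>2)"
    unfolding sq by simp
  define x2 y2 c where "x2 = (LINT x|M. (X x)\<^sup>2)" and "y2 = (LINT x|M. (Y x)\<^sup>2)"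
    and "c = (LINT x|M. X x * Y x)"
  have "(LINT x|M. (X x + Y x) ^ 2) = (LINT x|M. (X x)\<^sup>2 + 2 * (X x * Y x) + (Y x)\<^sup>2)"
    by (intro Bochner_Integration.integral_cong) (auto simp: power2_eq_square algebra_simps)
  then have s: "(LINT x|M. (X x + Y x) ^ 2) = x2 + 2 * c + y2"
    by (simp add: x2_def y2_def c_def)
  have "(LINT x|M. (X x - Y x) ^ 2) = (LINT x|M. (X x)\<^sup>2 - 2 * (X x * Y x) + (Y x)\<^sup>2)"
    by (intro Bochner_Integration.integral_cong) (auto simp: power2_eq_square algebra_simps)
  then have d: "(LINT x|M. (X x - Y x) ^ 2) = x2 - 2 * c + y2"
    by (simp add: x2_def y2_def c_def)
  have "(LINT x|M. (X x)\<^sup>2 * (Y x)\<^sup>2) =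
      ((LINT x|M. (X x + Y x) ^ 4) + (LINT x|M. (X x - Y x) ^ 4)
        - 2 * (LINT x|M. X x ^ 4) - 2 * (LINT x|M. Y x ^ 4)) / 12"
    unfolding sq by simp
  also have "\<dots> = (3 * (x2 + 2 * c + y2)\<^sup>2 + 3 * (x2 - 2 * c + y2)\<^sup>2 - 2 * (3 * x2\<^sup>2) - 2 * (3 * y2\<^sup>2)) / 12"
    unfolding centered_real_gaussian_fourth_moment[OF M X]
      centered_real_gaussian_fourth_moment[OF M Y]
      centered_real_gaussian_fourth_moment[OF M S]
      centered_real_gaussian_fourth_moment[OF M D] s d by (simp add: x2_def y2_def)
  also have "\<dots> = x2 * y2 + 2 * c\<^sup>2"
    by (simp add: power2_eq_square field_simps)
  finally show "(LINT x|M. (X x)\<^sup>2 * (Y x)\<^sup>2) = (LINT x|M. (X x)\<^sup>2) * (LINT x|M. (Y x)\<^sup>2) + 2 * (LINT x|M. X x * Y x)\<^sup>2"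
    by (simp add: x2_def y2_def c_def)
qed

text \<open>Vanishing of \<open>E(a_i a_j)\<close> together with \<open>\<Lambda>\<close> fixes all
  covariances of the real and imaginary parts. The product of squared moduli splits into four
  products of real squares, each covered by the real Wick formula.\<close>

lemma complex_gaussian_law_wick:
  fixes \<Lambda> :: "complex ^ 'n ^ 'n::finite"
  assumes "is_complex_gaussian_law \<Lambda> \<mu>"
  shows complex_gaussian_law_integrable_squares:
      "integrable \<mu> (\<lambda>a. (cmod (a $ i))\<^sup>2 * (cmod (a $ j))\<^sup>2)"
    and complex_gaussian_law_wick_squares:
      "(LINT a|\<mu>. (cmod (a $ i))\<^sup>2 * (cmod (a $ j))\<^sup>2) =
        Re (\<Lambda> $ i $ i) * Re (\<Lambda> $ j $ j) + (cmod (\<Lambda> $ i $ j))\<^sup>2"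
proof -
  have \<mu>: "prob_space \<mu>"
    and lin: "centered_real_gaussian \<mu> (\<lambda>a. Re (\<Sum>i\<in>UNIV. c $ i * a $ i))"
    and pseudo: "(LINT a|\<mu>. a $ i * a $ j) = 0"
    and cov: "(LINT a|\<mu>. a $ i * cnj (a $ j)) = \<Lambda> $ i $ j" for c i j
    using assms by (auto simp: is_complex_gaussian_law_def)
  have lin2: "centered_real_gaussian \<mu> (\<lambda>a. Re (\<alpha> * a $ i + \<beta> * a $ j))" for \<alpha> \<beta> i j
  proof -
    have "(\<Sum>k\<in>UNIV. (axis i \<alpha> + axis j \<beta>) $ k * a $ k) = \<alpha> * a $ i + \<beta> * a $ j" for a :: "complex ^ 'n"
      by (simp add: axis_def distrib_right sum.distrib if_distrib[of "\<lambda>x. x * _"] cong: if_cong)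
    then show ?thesis
      using lin[of "axis i \<alpha> + axis j \<beta>"] by simp
  qed
  \<comment> \<open>The flag selects the real part (\<open>True\<close>) or the imaginary part
    (\<open>False\<close>), so that one argument covers every pair of real coordinates.\<close>
  define R where "R = (\<lambda>(p :: 'n \<times> bool) (a :: complex ^ 'n). (if snd p then Re (a $ fst p) else Im (a $ fst p)))"
  define V where "V = (\<lambda>p q. LINT a|\<mu>. R p a * R q a)"
  \<comment> \<open>Imaginary parts are of the required form because Im w = Re (-i w).\<close>
  have rep: "\<exists>\<alpha>. \<forall>a. R p a = Re (\<alpha> * a $ fst p)" for p
    by (rule exI[of _ "if snd p then 1 else - \<i>"]) (auto simp: R_def)
  have G: "centered_real_gaussian \<mu> (R p)" "centered_real_gaussian \<mu> (\<lambda>a. R p a + R q a)"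
    "centered_real_gaussian \<mu> (\<lambda>a. R p a - R q a)" for p q
  proof -
    obtain \<alpha> where \<alpha>: "R p = (\<lambda>a. Re (\<alpha> * a $ fst p))" using rep[of p] by auto
    obtain \<beta> where \<beta>: "R q = (\<lambda>a. Re (\<beta> * a $ fst q))" using rep[of q] by auto
    show "centered_real_gaussian \<mu> (R p)"
      using lin2[of \<alpha> "fst p" 0] by (simp add: \<alpha>)
    show "centered_real_gaussian \<mu> (\<lambda>a. R p a + R q a)"
      using lin2[of \<alpha> "fst p" \<beta> "fst q"] by (simp add: \<alpha> \<beta>)
    show "centered_real_gaussian \<mu> (\<lambda>a. R p a - R q a)"
      using lin2[of \<alpha> "fst p" "- \<beta>" "fst q"] by (simp add: \<alpha> \<beta> algebra_simps)
  qed
  have I [simp]: "integrable \<mu> (\<lambda>a. R p a * R q a)" "integrable \<mu> (\<lambda>a. (R p a)\<^sup>2 * (R q a)\<^sup>2)"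
    and W: "(LINT a|\<mu>. (R p a)\<^sup>2 * (R q a)\<^sup>2) = V p p * V q q + 2 * (V p q)\<^sup>2" for p q
    using centered_real_gaussian_wick[OF \<mu> G(1)[of p] G(1)[of q] G(2,3)]
    by (auto simp: V_def power2_eq_square)
  have Ri [simp]: "R (i, True) a = Re (a $ i)" "R (i, False) a = Im (a $ i)" for i a
    by (auto simp: R_def)
  have mult: "a $ i * a $ j = Complex (R (i, True) a * R (j, True) a - R (i, False) a * R (j, False) a)
      (R (i, True) a * R (j, False) a + R (i, False) a * R (j, True) a)"
    and mult_cnj: "a $ i * cnj (a $ j) = Complex (R (i, True) a * R (j, True) a + R (i, False) a * R (j, False) a)
      (R (i, False) a * R (j, True) a - R (i, True) a * R (j, False) a)" for i j a
    by (auto simp: complex_eq_iff)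
  have CI: "(LINT a|\<mu>. Complex (f a) (g a)) = Complex (LINT a|\<mu>. f a) (LINT a|\<mu>. g a)"
    if "integrable \<mu> f" "integrable \<mu> g" for f g
    using that by (simp add: Complex_eq)
  have "Complex (V (i, True) (j, True) - V (i, False) (j, False)) (V (i, True) (j, False) + V (i, False) (j, True)) = 0"
    "Complex (V (i, True) (j, True) + V (i, False) (j, False)) (V (i, False) (j, True) - V (i, True) (j, False)) = \<Lambda> $ i $ j" for i j
    unfolding pseudo[of i j, symmetric] cov[symmetric] mult mult_cnj V_def
    by (simp_all add: CI del: Ri)
  \<comment> \<open>The two complex equations are four real ones, a sum and a difference for each of
    two pairs of unknowns; hence the halves.\<close>
  then have V: "V (i, True) (j, True) = Re (\<Lambda> $ i $ j) / 2" "V (i, False) (j, False) = Re (\<Lambda> $ i $ j) / 2"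
    "V (i, False) (j, True) = Im (\<Lambda> $ i $ j) / 2" "V (i, True) (j, False) = - Im (\<Lambda> $ i $ j) / 2" for i j
    by (simp_all add: complex_eq_iff) (smt (verit) field_sum_of_halves)+
  have norm: "(cmod (a $ i))\<^sup>2 * (cmod (a $ j))\<^sup>2 =
      (R (i, True) a)\<^sup>2 * (R (j, True) a)\<^sup>2 + (R (i, True) a)\<^sup>2 * (R (j, False) a)\<^sup>2
      + (R (i, False) a)\<^sup>2 * (R (j, True) a)\<^sup>2 + (R (i, False) a)\<^sup>2 * (R (j, False) a)\<^sup>2" for a
    by (simp add: cmod_power2 algebra_simps)
  show "integrable \<mu> (\<lambda>a. (cmod (a $ i))\<^sup>2 * (cmod (a $ j))\<^sup>2)"
    unfolding norm by (simp del: Ri)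
  show "(LINT a|\<mu>. (cmod (a $ i))\<^sup>2 * (cmod (a $ j))\<^sup>2) =
        Re (\<Lambda> $ i $ i) * Re (\<Lambda> $ j $ j) + (cmod (\<Lambda> $ i $ j))\<^sup>2"
    unfolding norm by (simp add: W V del: Ri) (simp add: cmod_power2, simp add: power2_eq_square field_simps)
qed

section \<open>Construction of complex Gaussian laws from independent standard normals\<close>

text \<open>The law is the image of a product of standard normal measures under the real-linear map
  with coefficients \<open>\<tau>\<close>; the two hypotheses prescribe the second moments of that
  image.\<close>

lemma complex_gaussian_law_exists_real_coordinates:
  fixes \<tau> :: "'n::finite \<Rightarrow> 'p::finite \<Rightarrow> complex"
  assumes pseudo: "\<And>i j. (\<Sum>k\<in>UNIV. \<tau> i k * \<tau> j k) = 0"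
    and cov: "\<And>i j. (\<Sum>k\<in>UNIV. \<tau> i k * cnj (\<tau> j k)) = \<Lambda> $ i $ j"
  shows "\<exists>\<mu>. is_complex_gaussian_law \<Lambda> \<mu>"
proof -
  define N where "N = density lborel (\<lambda>x. ennreal (std_normal_density x))"
  define P where "P = PiM (UNIV :: 'p set) (\<lambda>_. N)"
  have N: "prob_space N"
    unfolding N_def by (rule prob_space_normal_density) simp
  have [measurable_cong, simp]: "sets N = sets borel"
    by (simp add: N_def)
  interpret P: prob_space P
    unfolding P_def by (intro prob_space_PiM N)
  have meas [measurable]: "(\<lambda>\<omega>. \<omega> k) \<in> borel_measurable P" for k
    unfolding P_def by measurable
  have distr: "distr P borel (\<lambda>\<omega>. \<omega> k) = N" for k
  proof -
    have "distr P borel (\<lambda>\<omega>. \<omega> k) = distr P N (\<lambda>\<omega>. \<omega> k)"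
      by (rule distr_cong) auto
    then show ?thesis
      unfolding P_def by (simp add: distr_PiM_component[of UNIV "\<lambda>_. N"] N)
  qed
  have indep: "P.indep_vars (\<lambda>_. borel) (\<lambda>k \<omega>. \<omega> k) UNIV"
  proof (subst P.indep_vars_iff_distr_eq_PiM)
    \<comment> \<open>Restriction to \<open>UNIV\<close> is the identity, so the joint law of the
      coordinates is \<open>P\<close> itself, which is the product of their marginals.\<close>
    have "distr P (\<Pi>\<^sub>M i\<in>UNIV. borel) (\<lambda>x. \<lambda>i\<in>UNIV. x i) = distr P P (\<lambda>x. x)"
      by (intro distr_cong) (auto simp: P_def intro!: sets_PiM_cong)
    then show "distr P (\<Pi>\<^sub>M i\<in>UNIV. borel) (\<lambda>x. \<lambda>i\<in>UNIV. x i) =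
        (\<Pi>\<^sub>M i\<in>UNIV. distr P borel (\<lambda>\<omega>. \<omega> i))"
      by (simp add: distr) (simp add: P_def)
  qed auto
  have dist: "distributed P lborel (\<lambda>\<omega>. \<omega> k) (\<lambda>x. ennreal (std_normal_density x))" for k
  proof -
    have "distr P lborel (\<lambda>\<omega>. \<omega> k) = distr P borel (\<lambda>\<omega>. \<omega> k)"
      by (rule distr_cong) auto
    then show ?thesis
      by (auto simp: distributed_def distr N_def)
  qed
  have gauss: "centered_real_gaussian P (\<lambda>\<omega>. \<Sum>k\<in>UNIV. r k * \<omega> k)" for r :: "'p \<Rightarrow> real"
  proof (cases "\<forall>k. r k = 0")
    case True
    then show ?thesis
      by (simp add: centered_real_gaussian_def)
  next
    case False
    \<comment> \<open>The convolution rule for independent normals asks for positive variances and a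
      nonempty index set, so zero coefficients are dropped; if all vanish, the sum is the degenerate
      Gaussian treated above.\<close>
    define K where "K = {k. r k \<noteq> 0}"
    have K: "finite K" "K \<noteq> {}"
      using False by (auto simp: K_def)
    have "P.indep_vars (\<lambda>_. borel) (\<lambda>k \<omega>. r k * \<omega> k) K"
      by (rule P.indep_vars_compose2[OF P.indep_vars_subset[OF indep]]) auto
    moreover have "distributed P lborel (\<lambda>\<omega>. r k * \<omega> k) (normal_density 0 \<bar>r k\<bar>)" if "k \<in> K" for k
      using P.normal_density_affine[OF dist[of k], of "r k" 0] that by (simp add: K_def)
    ultimately have "distributed P lborel (\<lambda>\<omega>. \<Sum>k\<in>K. r k * \<omega> k)
        (normal_density (\<Sum>k\<in>K. 0) (sqrt (\<Sum>k\<in>K. \<bar>r k\<bar>\<^sup>2)))"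
      using K by (intro P.sum_indep_normal) (auto simp: K_def)
    moreover have "(\<Sum>k\<in>K. r k * \<omega> k) = (\<Sum>k\<in>UNIV. r k * \<omega> k)" for \<omega>
      by (rule sum.mono_neutral_left) (auto simp: K_def)
    moreover have "sqrt (\<Sum>k\<in>K. \<bar>r k\<bar>\<^sup>2) > 0"
      using K by (auto simp: K_def intro!: sum_pos)
    ultimately show ?thesis
      unfolding centered_real_gaussian_def by auto
  qed
  have single: "centered_real_gaussian P (\<lambda>\<omega>. \<omega> k)" for k
    using gauss[of "\<lambda>l. if l = k then 1 else 0"] by (simp add: if_distrib[of "\<lambda>x. x * _"] cong: if_cong)
  have int1: "integrable P (\<lambda>\<omega>. \<omega> k)" for k
    using centered_real_gaussian_integrable_power[OF P.prob_space_axioms single[of k], where k = 1] by simp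
  have mean: "(LINT \<omega>|P. \<omega> k) = 0" for k
    using P.standard_normal_distributed_expectation[OF dist[of k]] by simp
  have prod: "integrable P (\<lambda>\<omega>. \<omega> k * \<omega> l) \<and> (LINT \<omega>|P. \<omega> k * \<omega> l) = (if k = l then 1 else 0)" for k l
  proof (cases "k = l")
    case True
    have "(LINT \<omega>|P. \<omega> k ^ 2) = 1"
      using P.standard_normal_distributed_variance[OF dist[of k]] by (simp add: mean)
    then show ?thesis
      using True centered_real_gaussian_integrable_power[OF P.prob_space_axioms single[of k], where k = 2]
      by (simp add: power2_eq_square)
  next
    case False
    have sub: "P.indep_vars (\<lambda>_. borel) (\<lambda>k \<omega>. \<omega> k) {k, l}"
      by (rule P.indep_vars_subset[OF indep]) auto
    show ?thesis
      using P.indep_vars_integrable[OF _ sub int1] P.indep_vars_lebesgue_integral[OF _ sub int1] False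
      by (simp add: mean)
  qed
  define F where "F = (\<lambda>\<omega> :: 'p \<Rightarrow> real. \<chi> i :: 'n. \<Sum>k\<in>UNIV. \<tau> i k * complex_of_real (\<omega> k))"
  have F_nth: "F \<omega> $ i = (\<Sum>k\<in>UNIV. \<tau> i k * complex_of_real (\<omega> k))" for \<omega> i
    by (simp add: F_def)
  have F [measurable]: "F \<in> borel_measurable P"
  proof -
    \<comment> \<open>Measurability of a vector-valued map is reduced to its coordinates through the
      continuous linear embeddings \<open>axis i\<close>.\<close>
    have "F = (\<lambda>\<omega>. \<Sum>i\<in>UNIV. axis i (\<Sum>k\<in>UNIV. \<tau> i k * complex_of_real (\<omega> k)))"
      by (auto simp: F_def vec_eq_iff axis_def fun_eq_iff)
    moreover have "(\<lambda>x :: complex. axis (i :: 'n) x) \<in> borel_measurable borel" for i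
      by (intro borel_measurable_continuous_onI linear_continuous_on)
         (auto simp: linear_conv_bounded_linear[symmetric] axis_def vec_eq_iff intro!: linearI)
    ultimately show ?thesis
      by simp
  qed
  have [measurable]: "(\<lambda>a :: complex ^ 'n. a $ i) \<in> borel_measurable borel" for i
    by (intro borel_measurable_continuous_onI continuous_intros)
  \<comment> \<open>The coordinates are orthonormal, so only diagonal terms survive. Without a
    conjugation this serves both second moments: as each \<open>\<omega> k\<close> is real,
    conjugating a linear form only conjugates its coefficients.\<close>
  have bil: "(LINT \<omega>|P. (\<Sum>k\<in>UNIV. f k * complex_of_real (\<omega> k)) * (\<Sum>l\<in>UNIV. g l * complex_of_real (\<omega> l))) =
      (\<Sum>k\<in>UNIV. f k * g k)" for f g :: "'p \<Rightarrow> complex"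
  proof -
    have I: "complex_integrable P (\<lambda>\<omega>. complex_of_real (\<omega> k * \<omega> l))" for k l
      using prod by (intro integrable_of_real) auto
    have "(LINT \<omega>|P. (\<Sum>k\<in>UNIV. f k * complex_of_real (\<omega> k)) * (\<Sum>l\<in>UNIV. g l * complex_of_real (\<omega> l))) =
        (LINT \<omega>|P. (\<Sum>k\<in>UNIV. \<Sum>l\<in>UNIV. f k * g l * complex_of_real (\<omega> k * \<omega> l)))"
      by (simp add: sum_product mult_ac)
    also have "\<dots> = (\<Sum>k\<in>UNIV. \<Sum>l\<in>UNIV. f k * g l * (LINT \<omega>|P. complex_of_real (\<omega> k * \<omega> l)))"
      using I by simp
    also have "\<dots> = (\<Sum>k\<in>UNIV. \<Sum>l\<in>UNIV. f k * g l * complex_of_real (LINT \<omega>|P. \<omega> k * \<omega> l))"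
      by (simp del: of_real_mult)
    finally show ?thesis
      by (simp add: prod if_distrib cong: if_cong)
  qed
  have "is_complex_gaussian_law \<Lambda> (distr P borel F)"
    unfolding is_complex_gaussian_law_def
  proof (intro conjI allI)
    show "prob_space (distr P borel F)"
      by (rule P.prob_space_distr) measurable
  next
    fix c :: "complex ^ 'n"
    let ?f = "\<lambda>a. Re (\<Sum>i\<in>UNIV. c $ i * a $ i)"
    have f [measurable]: "?f \<in> borel_measurable borel"
      by measurable
    have "?f (F \<omega>) = (\<Sum>k\<in>UNIV. Re (\<Sum>i\<in>UNIV. c $ i * \<tau> i k) * \<omega> k)" for \<omega>
    proof -
      have "(\<Sum>i\<in>UNIV. c $ i * F \<omega> $ i) = (\<Sum>k\<in>UNIV. (\<Sum>i\<in>UNIV. c $ i * \<tau> i k) * complex_of_real (\<omega> k))"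
        by (simp add: F_def sum_distrib_left sum_distrib_right mult_ac) (rule sum.swap)
      then show ?thesis
        by (simp add: Re_sum del: sum_distrib_right)
    qed
    then have G: "centered_real_gaussian P (\<lambda>\<omega>. ?f (F \<omega>))"
      using gauss by simp
    have "distr P lborel (\<lambda>\<omega>. ?f (F \<omega>)) = distr (distr P borel F) lborel ?f"
      by (subst distr_distr) (auto simp: comp_def)
    then show "centered_real_gaussian (distr P borel F) ?f"
      using G unfolding centered_real_gaussian_def distributed_def
      by (simp add: AE_distr_iff del: Re_sum)
  next
    fix i j
    show "(LINT a|distr P borel F. a $ i * a $ j) = 0"
      by (subst integral_distr) (auto simp: F_nth bil pseudo)
    show "(LINT a|distr P borel F. a $ i * cnj (a $ j)) = \<Lambda> $ i $ j"
      by (subst integral_distr)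
         (auto simp: F_nth bil cov intro!: borel_measurable_continuous_onI continuous_intros)
  qed simp
  then show ?thesis ..
qed

text \<open>Each complex coordinate is fed by standard complex noise
  \<open>(x + i y) / sqrt 2\<close> with \<open>x\<close>, \<open>y\<close> real standard normals.
  Since 1 + i^2 = 0 the pseudo-covariance cancels, while the squared moduli add up to 1 and leave
  \<open>T T^*\<close>.\<close>

lemma complex_gaussian_law_exists:
  fixes T :: "complex ^ 'k::finite ^ 'n::finite"
  shows "\<exists>\<mu>. is_complex_gaussian_law (T ** conj_transpose T) \<mu>"
proof (rule complex_gaussian_law_exists_real_coordinates)
  let ?\<tau> = "\<lambda>i (k, b). T $ i $ k * (if b then 1 else \<i>) / complex_of_real (sqrt 2)"
  have s: "complex_of_real (sqrt 2) * complex_of_real (sqrt 2) = 2"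
    by (simp flip: of_real_mult)
  have pairs: "(\<Sum>k\<in>UNIV. f k) = (\<Sum>k\<in>UNIV. f (k, True) + f (k, False))" for f :: "'k \<times> bool \<Rightarrow> complex"
    by (simp add: UNIV_Times_UNIV[symmetric] sum.cartesian_product' UNIV_bool add.commute
        del: UNIV_Times_UNIV)
  fix i j
  show "(\<Sum>k\<in>UNIV. ?\<tau> i k * ?\<tau> j k) = 0"
    by (simp add: pairs field_simps s)
  show "(\<Sum>k\<in>UNIV. ?\<tau> i k * cnj (?\<tau> j k)) = (T ** conj_transpose T) $ i $ j"
    by (simp add: pairs field_simps s matrix_matrix_mult_def conj_transpose_def)
qed

subsection \<open>The limit covariance matrices\<close>

lemma herm_dot_self: "herm_dot z z = complex_of_real ((norm z)\<^sup>2)"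
  by (simp add: herm_dot_def norm_vec_def L2_set_def sum_nonneg complex_norm_square flip: of_real_power)

lemma herm_dot_commute: "herm_dot w z = cnj (herm_dot z w)"
  by (simp add: herm_dot_def mult.commute)

lemma herm_dot_diff: "herm_dot (x - y) (x - y) = herm_dot x x + herm_dot y y - (herm_dot x y + herm_dot y x)"
  by (simp add: herm_dot_def algebra_simps sum.distrib sum_subtractf)

lemma norm_diff_square_herm_dot:
  "(norm (x - y))\<^sup>2 = (norm x)\<^sup>2 + (norm y)\<^sup>2 - 2 * Re (herm_dot x y)"
proof -
  have "complex_of_real ((norm (x - y))\<^sup>2) =
      complex_of_real ((norm x)\<^sup>2) + complex_of_real ((norm y)\<^sup>2) - (herm_dot x y + herm_dot y x)"
    unfolding herm_dot_self[symmetric] by (rule herm_dot_diff)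
  also have "herm_dot x y + herm_dot y x = complex_of_real (2 * Re (herm_dot x y))"
    by (subst herm_dot_commute[of y]) (rule complex_add_cnj)
  finally show ?thesis
    by (metis of_real_add of_real_diff of_real_eq_iff)
qed

lemma matA_diagonal: "matA z $ p $ p = complex_of_real (exp ((norm (z $ p))\<^sup>2))"
  by (simp add: matA_def herm_dot_self flip: exp_of_real)

lemma matA_hermitian: "matA z $ p' $ p = cnj (matA z $ p $ p')"
  by (simp add: matA_def herm_dot_commute[of "z $ p'"] exp_cnj)

text \<open>This is the expansion of |z1 - z2|^2, exponentiated:
  \<open>A_11 A_22 = |A_12|^2 exp(|u|^2)\<close>. Through it the positions of the individual points
  later cancel.\<close>

lemma norm_matA_mult_exp:
  "(cmod (matA z $ 1 $ 2))\<^sup>2 * exp ((norm (z $ 1 - z $ 2))\<^sup>2) =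
    exp ((norm (z $ 1))\<^sup>2) * exp ((norm (z $ 2))\<^sup>2)"
  by (simp add: matA_def norm_diff_square_herm_dot exp_double[symmetric] flip: exp_add)

lemma det_matA:
  "det (matA z) = complex_of_real ((cmod (matA z $ 1 $ 2))\<^sup>2 * (exp ((norm (z $ 1 - z $ 2))\<^sup>2) - 1))"
proof -
  have "det (matA z) = complex_of_real (exp ((norm (z $ 1))\<^sup>2) * exp ((norm (z $ 2))\<^sup>2)) -
      matA z $ 1 $ 2 * cnj (matA z $ 1 $ 2)"
    by (simp add: det_2 matA_diagonal matA_hermitian[of z 2 1])
  also have "\<dots> = complex_of_real (exp ((norm (z $ 1))\<^sup>2) * exp ((norm (z $ 2))\<^sup>2)) -
      complex_of_real ((cmod (matA z $ 1 $ 2))\<^sup>2)"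
    by (simp only: complex_norm_square)
  finally show ?thesis
    unfolding norm_matA_mult_exp[symmetric] by (simp add: algebra_simps)
qed

text \<open>\<open>matrix_inv\<close> is defined by choice, so the adjugate formula is checked to be
  an inverse and then identified with it by uniqueness of inverses.\<close>

lemma matrix_inv_2:
  fixes A :: "'a::field ^ 2 ^ 2"
  assumes "det A \<noteq> 0"
  shows "matrix_inv A = vector [vector [A $ 2 $ 2 / det A, - A $ 1 $ 2 / det A],
      vector [- A $ 2 $ 1 / det A, A $ 1 $ 1 / det A]]" (is "_ = ?I")
proof -
  have "A ** ?I = mat 1"
    using assms by (simp add: vec_eq_iff matrix_matrix_mult_def mat_def forall_2 sum_2 divide_simps)
      (simp add: det_2 algebra_simps)
  then have "?I ** A = mat 1" "invertible A"
    by (auto simp: matrix_left_right_inverse invertible_def)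
  moreover have "A ** matrix_inv A = mat 1"
    using \<open>invertible A\<close> unfolding invertible_def matrix_inv_def
    by (metis (mono_tags, lifting) someI_ex)
  moreover have "matrix_inv A = ?I ** A ** matrix_inv A"
    using calculation(1) by simp
  ultimately show ?thesis
    unfolding matrix_mul_assoc[symmetric] by simp
qed

text \<open>
  In terms of \<open>u = z1 - z2\<close> the Schur complement collapses: subtracting multiples of the
  function values removes the individual points from the derivatives.
\<close>

lemma matLambda_nth:
  fixes z :: "(complex ^ 'm::finite) ^ 2"
  assumes "z $ 1 \<noteq> z $ 2"
  defines "u \<equiv> z $ 1 - z $ 2"
  defines "v \<equiv> 1 / (exp ((norm u)\<^sup>2) - 1)"
  shows "matLambda z $ (p, q) $ (p', q') = matA z $ p $ p' *
    ((if q = q' then 1 else 0) - complex_of_real (if p = p' then v else 1 + v) * cnj (u $ q) * u $ q')"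
proof -
  define a b b' d D E where "a = matA z $ 1 $ 1" and "b = matA z $ 1 $ 2" and "b' = matA z $ 2 $ 1"
    and "d = matA z $ 2 $ 2" and "D = a * d - b * b'" and "E = complex_of_real (exp ((norm u)\<^sup>2))"
  have E: "E \<noteq> 1"
    using assms by (auto simp: E_def)
  have b: "b \<noteq> 0" "b' \<noteq> 0"
    by (auto simp: b_def b'_def matA_def)
  have bb: "b * b' = complex_of_real ((cmod b)\<^sup>2)"
    unfolding complex_norm_square b_def b'_def matA_hermitian[of z 2 1] ..
  have ad: "a * d = b * b' * E"
    unfolding bb
    unfolding E_def u_def a_def b_def d_def matA_diagonal of_real_mult[symmetric] norm_matA_mult_exp ..
  have D: "D = b * b' * (E - 1)" "det (matA z) = D"
    by (simp add: D_def ad algebra_simps) (simp add: D_def det_2 a_def b_def b'_def d_def)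
  have D0: "D \<noteq> 0"
    using b E by (simp add: D)
  \<comment> \<open>These are the forms in which \<open>v\<close> and \<open>1 + v\<close> come out
    of the Schur complement: the first on the diagonal blocks, the second off them.\<close>
  have v: "complex_of_real v = b * b' / D" "1 + b * b' / D = a * d / D"
    unfolding ad D using b E by (simp_all add: v_def E_def field_simps)
  have inv: "matrix_inv (matA z) = vector [vector [d / D, - b / D], vector [- b' / D, a / D]]"
    using matrix_inv_2[of "matA z"] D0 by (simp add: D a_def b_def b'_def d_def)
  have cnj: "cnj b = b'" "cnj b' = b" "cnj a = a" "cnj d = d"
    unfolding a_def b_def b'_def d_def by (simp_all flip: matA_hermitian)
  have e: "exp (herm_dot (z $ 1) (z $ 1)) = a" "exp (herm_dot (z $ 1) (z $ 2)) = b"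
    "exp (herm_dot (z $ 2) (z $ 1)) = b'" "exp (herm_dot (z $ 2) (z $ 2)) = d"
    by (auto simp: a_def b_def b'_def d_def matA_def)
  define x1 x2 c1 c2 where "x1 = z $ 1 $ q'" and "x2 = z $ 2 $ q'"
    and "c1 = cnj (z $ 1 $ q)" and "c2 = cnj (z $ 2 $ q)"
  note defs = x1_def[symmetric] x2_def[symmetric] c1_def[symmetric] c2_def[symmetric]
  have u: "cnj (u $ q) = c1 - c2" "u $ q' = x1 - x2"
    by (simp_all add: u_def x1_def x2_def c1_def c2_def)
  define \<delta> :: complex where "\<delta> = (if q = q' then 1 else 0)"
  consider "p = 1" "p' = 1" | "p = 1" "p' = 2" | "p = 2" "p' = 1" | "p = 2" "p' = 2"
    using exhaust_2 by metis
  then show ?thesis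
  proof cases
    case 1
    have "matLambda z $ (p, q) $ (p', q') = (\<delta> + c1 * x1) * a -
        ((c1 * a * (d / D) + c2 * b * (- b' / D)) * (x1 * a) + (c1 * a * (- b / D) + c2 * b * (a / D)) * (x2 * b'))"
      by (simp add: 1 matLambda_def matC_def matB_def conj_transpose_def matrix_matrix_mult_def sum_2 inv e cnj defs flip: \<delta>_def)
    \<comment> \<open>After clearing the denominator and expanding \<open>D\<close> this is a
      polynomial identity; the other three cases follow the same pattern.\<close>
    also have "\<dots> = a * (\<delta> - b * b' / D * (c1 - c2) * (x1 - x2))"
      using D0 by (simp add: divide_simps) (simp add: D_def algebra_simps)
    finally show ?thesis
      by (simp add: 1 u v \<delta>_def flip: a_def)
  next
    case 2
    have "matLambda z $ (p, q) $ (p', q') = (\<delta> + c2 * x1) * b -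
        ((c1 * a * (d / D) + c2 * b * (- b' / D)) * (x1 * b) + (c1 * a * (- b / D) + c2 * b * (a / D)) * (x2 * d))"
      by (simp add: 2 matLambda_def matC_def matB_def conj_transpose_def matrix_matrix_mult_def sum_2 inv e cnj defs flip: \<delta>_def)
    also have "\<dots> = b * (\<delta> - a * d / D * (c1 - c2) * (x1 - x2))"
      using D0 by (simp add: divide_simps) (simp add: D_def algebra_simps)
    finally show ?thesis
      by (simp add: 2 u v \<delta>_def flip: b_def)
  next
    case 3
    have "matLambda z $ (p, q) $ (p', q') = (\<delta> + c1 * x2) * b' -
        ((c1 * b' * (d / D) + c2 * d * (- b' / D)) * (x1 * a) + (c1 * b' * (- b / D) + c2 * d * (a / D)) * (x2 * b'))"
      by (simp add: 3 matLambda_def matC_def matB_def conj_transpose_def matrix_matrix_mult_def sum_2 inv e cnj defs flip: \<delta>_def)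
    also have "\<dots> = b' * (\<delta> - a * d / D * (c1 - c2) * (x1 - x2))"
      using D0 by (simp add: divide_simps) (simp add: D_def algebra_simps)
    finally show ?thesis
      by (simp add: 3 u v \<delta>_def flip: b'_def)
  next
    case 4
    have "matLambda z $ (p, q) $ (p', q') = (\<delta> + c2 * x2) * d -
        ((c1 * b' * (d / D) + c2 * d * (- b' / D)) * (x1 * b) + (c1 * b' * (- b / D) + c2 * d * (a / D)) * (x2 * d))"
      by (simp add: 4 matLambda_def matC_def matB_def conj_transpose_def matrix_matrix_mult_def sum_2 inv e cnj defs flip: \<delta>_def)
    also have "\<dots> = d * (\<delta> - b * b' / D * (c1 - c2) * (x1 - x2))"
      using D0 by (simp add: divide_simps) (simp add: D_def algebra_simps)
    finally show ?thesis
      by (simp add: 4 u v \<delta>_def flip: d_def)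
  qed
qed

section \<open>Factorizations of positive semidefinite matrices\<close>

text \<open>A lower triangular factor exists as soon as the first pivot is positive and the
  determinant is nonnegative; a singular \<open>H\<close> is allowed and makes the last diagonal
  entry zero.\<close>

lemma cholesky_2:
  fixes H :: "complex ^ 2 ^ 2"
  assumes "H $ 1 $ 1 = complex_of_real x" "H $ 2 $ 2 = complex_of_real y" "H $ 2 $ 1 = cnj (H $ 1 $ 2)"
    and "x > 0" and "(cmod (H $ 1 $ 2))\<^sup>2 \<le> x * y"
  shows "\<exists>T :: complex ^ 2 ^ 2. T ** conj_transpose T = H"
proof -
  define c where "c = H $ 1 $ 2"
  define s where "s = complex_of_real (sqrt x)"
  \<comment> \<open>The radicand is the second pivot, the determinant of \<open>H\<close> divided by
    \<open>x\<close>.\<close>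
  define r where "r = complex_of_real (sqrt (y - (cmod c)\<^sup>2 / x))"
  have s: "s \<noteq> 0" "s * s = complex_of_real x" "cnj s = s"
    using assms(4) by (simp_all add: s_def flip: of_real_mult)
  have "r * r = complex_of_real (y - (cmod c)\<^sup>2 / x)"
    using assms(4,5) by (simp add: r_def c_def field_simps flip: of_real_mult)
  then have r: "r * r = complex_of_real y - c * cnj c / complex_of_real x" "cnj r = r"
    by (simp_all only: of_real_diff of_real_divide complex_norm_square) (simp add: r_def)
  let ?T = "vector [vector [s, 0], vector [cnj c / s, r]] :: complex ^ 2 ^ 2"
  have "?T ** conj_transpose ?T = H"
    using s(1) assms(1-3)
    by (simp add: vec_eq_iff forall_2 matrix_matrix_mult_def conj_transpose_def sum_2 s r flip: c_def)
  then show ?thesis ..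
qed

lemma matrix_diff_ldistrib: "(A :: 'a::ring_1 ^ 'n::finite ^ 'm) ** (B - C) = A ** B - A ** C"
  and matrix_diff_rdistrib: "(A' - B' :: 'a::ring_1 ^ 'n::finite ^ 'm) ** C' = A' ** C' - B' ** C'"
  by (simp_all add: vec_eq_iff matrix_matrix_mult_def algebra_simps sum_subtractf)

text \<open>
  \<open>\<Lambda> = H \<otimes> (1 - E) + G \<otimes> E\<close> factors as \<open>T T\<^sup>*\<close> with \<open>T = R \<otimes> (1 - E) + S \<otimes> E\<close>,
  since the projections \<open>E\<close> and \<open>1 - E\<close> annihilate each other.
\<close>

lemma complex_gaussian_law_exists_projection:
  fixes E :: "complex ^ 'm ^ 'm::finite" and H G R S :: "complex ^ 2 ^ 2"
  assumes herm: "\<And>i j. E $ j $ i = cnj (E $ i $ j)"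
    and idem: "\<And>i j. (\<Sum>k\<in>UNIV. E $ i $ k * E $ k $ j) = E $ i $ j"
    and R: "R ** conj_transpose R = H" and S: "S ** conj_transpose S = G"
    and \<Lambda>: "\<And>p q p' q'. \<Lambda> $ (p, q) $ (p', q') =
      H $ p $ p' * ((if q = q' then 1 else 0) - E $ q $ q') + G $ p $ p' * E $ q $ q'"
  shows "\<exists>\<mu>. is_complex_gaussian_law \<Lambda> \<mu>"
proof -
  define I :: "complex ^ 'm ^ 'm" where "I = mat 1"
  define T :: "complex ^ (2 \<times> 'm) ^ (2 \<times> 'm)" where
    "T = (\<chi> j k. R $ fst j $ fst k * (I - E) $ snd j $ snd k + S $ fst j $ fst k * E $ snd j $ snd k)"
  have I: "I $ i $ j = (if i = j then 1 else 0)" for i j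
    by (simp add: I_def mat_def)
  have c: "cnj (I $ i $ j) = I $ j $ i" "cnj (E $ i $ j) = E $ j $ i" for i j
    by (simp_all add: I herm[of i j])
  have "E ** E = E"
    using idem by (simp add: vec_eq_iff matrix_matrix_mult_def)
  then have P: "(I - E) ** (I - E) = I - E" "(I - E) ** E = 0" "E ** (I - E) = 0" "E ** E = E"
    by (simp_all add: I_def matrix_diff_ldistrib matrix_diff_rdistrib)
  have sums: "(\<Sum>k\<in>UNIV. X $ q $ k * Y $ k $ q') = (X ** Y) $ q $ q'" for X Y :: "complex ^ 'm ^ 'm" and q q'
    by (simp add: matrix_matrix_mult_def)
  have "(T ** conj_transpose T) $ (p, q) $ (p', q') = \<Lambda> $ (p, q) $ (p', q')" for p q p' q'
  proof -
    \<comment> \<open>As \<open>E\<close> and \<open>I\<close> are Hermitian, conjugated entries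
      become entries with swapped indices, and the inner sums turn into matrix products of the
      projections.\<close>
    have "(T ** conj_transpose T) $ (p, q) $ (p', q') = (\<Sum>s\<in>UNIV. \<Sum>k\<in>UNIV.
        (R $ p $ s * (I - E) $ q $ k + S $ p $ s * E $ q $ k) *
        (cnj (R $ p' $ s) * (I - E) $ k $ q' + cnj (S $ p' $ s) * E $ k $ q'))"
      by (simp add: matrix_matrix_mult_def conj_transpose_def T_def c UNIV_Times_UNIV[symmetric]
          sum.cartesian_product' del: UNIV_Times_UNIV)
    also have "\<dots> = (\<Sum>s\<in>UNIV. R $ p $ s * cnj (R $ p' $ s) * (\<Sum>k\<in>UNIV. (I - E) $ q $ k * (I - E) $ k $ q') +
        R $ p $ s * cnj (S $ p' $ s) * (\<Sum>k\<in>UNIV. (I - E) $ q $ k * E $ k $ q') +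
        S $ p $ s * cnj (R $ p' $ s) * (\<Sum>k\<in>UNIV. E $ q $ k * (I - E) $ k $ q') +
        S $ p $ s * cnj (S $ p' $ s) * (\<Sum>k\<in>UNIV. E $ q $ k * E $ k $ q'))"
      unfolding sum_distrib_left sum.distrib[symmetric]
      by (intro sum.cong refl) (simp only: ring_distribs mult_ac add_ac)
    also have "\<dots> = (R ** conj_transpose R) $ p $ p' * (I - E) $ q $ q' + (S ** conj_transpose S) $ p $ p' * E $ q $ q'"
      unfolding sums P
      by (simp add: matrix_matrix_mult_def conj_transpose_def sum.distrib sum_distrib_right del: vector_minus_component)
    finally show ?thesis
      by (simp add: R S \<Lambda> I)
  qed
  then have "T ** conj_transpose T = \<Lambda>"
    by (auto simp: vec_eq_iff)
  then show ?thesis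
    using complex_gaussian_law_exists by metis
qed

subsection \<open>The pair correlation function\<close>

text \<open>Existence is what gives the chosen law its defining properties; Wick's formula then
  applies to each term of the expanded product. The first summand is the product of the traces of
  the diagonal blocks, the second the squared Hilbert-Schmidt norm of the off-diagonal
  block.\<close>

lemma gaussian_expectation_prod_sum_squares:
  fixes \<Lambda> :: "complex ^ (2 \<times> 'm::finite) ^ (2 \<times> 'm)"
  assumes "\<exists>\<mu>. is_complex_gaussian_law \<Lambda> \<mu>"
  shows "gaussian_expectation \<Lambda> (\<lambda>a. \<Prod>p\<in>UNIV. \<Sum>q\<in>UNIV. (cmod (a $ (p, q)))\<^sup>2) =
    (\<Sum>q\<in>UNIV. Re (\<Lambda> $ (1, q) $ (1, q))) * (\<Sum>q\<in>UNIV. Re (\<Lambda> $ (2, q) $ (2, q)))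
      + (\<Sum>q\<in>UNIV. \<Sum>q'\<in>UNIV. (cmod (\<Lambda> $ (1, q) $ (2, q')))\<^sup>2)"
proof -
  have law: "is_complex_gaussian_law \<Lambda> (complex_gaussian_law \<Lambda>)"
    unfolding complex_gaussian_law_def using assms by (rule someI_ex)
  have "gaussian_expectation \<Lambda> (\<lambda>a. \<Prod>p\<in>UNIV. \<Sum>q\<in>UNIV. (cmod (a $ (p, q)))\<^sup>2) =
      (LINT a|complex_gaussian_law \<Lambda>.
        (\<Sum>q\<in>UNIV. \<Sum>q'\<in>UNIV. (cmod (a $ (1, q)))\<^sup>2 * (cmod (a $ (2, q')))\<^sup>2))"
    by (simp add: gaussian_expectation_def UNIV_2 sum_product)
  also have "\<dots> = (\<Sum>q\<in>UNIV. \<Sum>q'\<in>UNIV. Re (\<Lambda> $ (1, q) $ (1, q)) * Re (\<Lambda> $ (2, q') $ (2, q'))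
      + (cmod (\<Lambda> $ (1, q) $ (2, q')))\<^sup>2)"
    by (simp add: complex_gaussian_law_integrable_squares[OF law] complex_gaussian_law_wick_squares[OF law])
  finally show ?thesis
    by (simp add: sum_product sum.distrib)
qed

section \<open>Positivity of the limit covariance\<close>

text \<open>Squaring 1 + s/2 \<le> exp(s/2) leaves the surplus s^2/4, which makes the inequality
  strict. It provides the positive first pivot of \<open>G\<close> below.\<close>

lemma less_exp_minus_one:
  fixes s :: real
  assumes "s > 0"
  shows "s < exp s - 1"
proof -
  have "(1 + s / 2)\<^sup>2 \<le> (exp (s / 2))\<^sup>2"
    using assms by (intro power_mono exp_ge_add_one_self) auto
  moreover have "(exp (s / 2))\<^sup>2 = exp s"
    by (simp flip: exp_double)
  moreover have "(1 + s / 2)\<^sup>2 = 1 + s + s\<^sup>2 / 4"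
    by (simp add: power2_eq_square field_simps)
  moreover have "s\<^sup>2 > 0"
    using assms by simp
  ultimately show ?thesis
    by linarith
qed

text \<open>After cancelling \<open>exp (s / 2) + 1\<close> this is \<open>s / 2 \<le> sinh (s / 2)\<close>.\<close>

lemma exp_minus_one_minus_times_exp_square_le:
  fixes s :: real
  assumes "s \<ge> 0"
  shows "(exp s - 1 - s * exp s)\<^sup>2 \<le> exp s * (exp s - 1 - s)\<^sup>2"
proof -
  define g where "g = exp (s / 2)"
  have g: "g > 0" "exp s = g\<^sup>2"
    by (simp_all add: g_def exp_double[symmetric])
  have "s \<le> g - 1 / g"
    using real_le_x_sinh[of "s / 2"] assms by (simp add: g_def inverse_eq_divide)
  then have "s * g \<le> g\<^sup>2 - 1"
    using g by (simp add: field_simps power2_eq_square)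
  then have "s * g * (g + 1) \<le> (g\<^sup>2 - 1) * (g + 1)"
    using g by (intro mult_right_mono) auto
  then have 1: "s * g\<^sup>2 - g\<^sup>2 + 1 \<le> g * (g\<^sup>2 - 1 - s)"
    by (simp add: algebra_simps power2_eq_square)
  have "exp (- s) \<ge> 1 - s"
    using exp_ge_add_one_self[of "- s"] by simp
  then have "(1 - s) * exp s \<le> exp (- s) * exp s"
    by (intro mult_right_mono) auto
  then have 2: "g\<^sup>2 - 1 - s * g\<^sup>2 \<le> 0"
    using g by (simp add: exp_minus field_simps)
  \<comment> \<open>By \<open>2\<close> the base on the left is nonpositive, so its absolute value
    is the left side of \<open>1\<close>.\<close>
  have "(g\<^sup>2 - 1 - s * g\<^sup>2)\<^sup>2 \<le> (g * (g\<^sup>2 - 1 - s))\<^sup>2"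
    using 1 2 by (intro power2_le_iff_abs_le[THEN iffD2]) auto
  then show ?thesis
    by (simp add: g power_mult_distrib)
qed

text \<open>The rank-one projection \<open>E\<close> splits the covariance into two 2 by 2 problems:
  \<open>A\<close> on the complement and \<open>G\<close> on the range. Both matrices have a
  positive first pivot and a nonnegative determinant.\<close>

lemma matLambda_gaussian_law_exists:
  fixes z :: "(complex ^ 'm::finite) ^ 2"
  assumes z: "z $ 1 \<noteq> z $ 2"
  shows "\<exists>\<mu>. is_complex_gaussian_law (matLambda z) \<mu>"
proof -
  define u where "u = z $ 1 - z $ 2"
  define s where "s = (norm u)\<^sup>2"
  define v where "v = 1 / (exp s - 1)"
  have s: "s > 0"
    using z by (simp add: s_def u_def)
  have nonzero: "s \<noteq> 0" "exp s - 1 > 0"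
    using s by auto
  define E :: "complex ^ 'm ^ 'm" where "E = (\<chi> i j. cnj (u $ i) * u $ j / complex_of_real s)"
  \<comment> \<open>On the range of \<open>E\<close> the matrix \<open>1 - \<lambda> u^* u\<close>
    acts as the scalar \<open>1 - s \<lambda>\<close>, with \<open>\<lambda> = v\<close> or
    \<open>1 + v\<close>.\<close>
  define h where "h = (\<lambda>p p' :: 2. if p = p' then 1 - s * v else 1 - s * (1 + v))"
  define G :: "complex ^ 2 ^ 2" where "G = (\<chi> p p'. matA z $ p $ p' * complex_of_real (h p p'))"
  define x y where "x = exp ((norm (z $ 1))\<^sup>2)" and "y = exp ((norm (z $ 2))\<^sup>2)"
  define c where "c = (cmod (matA z $ 1 $ 2))\<^sup>2"
  have xy: "x > 0" "y > 0" "c \<ge> 0" "x * y = c * exp s"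
    using norm_matA_mult_exp[of z] by (simp_all add: x_def y_def c_def s_def u_def)
  \<comment> \<open>As \<open>x * y = c * exp s\<close>, this says that det A is
    nonnegative.\<close>
  have "c * 1 \<le> c * exp s"
    using s xy by (intro mult_left_mono) auto
  then have "\<exists>R :: complex ^ 2 ^ 2. R ** conj_transpose R = matA z"
    using xy by (intro cholesky_2[of _ x y] matA_hermitian) (auto simp: matA_diagonal x_def y_def c_def)
  then obtain R :: "complex ^ 2 ^ 2" where R: "R ** conj_transpose R = matA z" ..
  have h11: "1 - s * v = (exp s - 1 - s) / (exp s - 1)"
    and h12: "1 - s * (1 + v) = (exp s - 1 - s * exp s) / (exp s - 1)"
    using nonzero by (simp_all add: v_def field_simps)
  have h0: "0 < 1 - s * v"
    using less_exp_minus_one[OF s] nonzero by (simp add: h11)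
  \<comment> \<open>Multiplied by \<open>c\<close>, this becomes nonnegativity of det G.\<close>
  have "(1 - s * (1 + v))\<^sup>2 \<le> exp s * (1 - s * v)\<^sup>2"
    unfolding h11 h12 power_divide times_divide_eq_right
    using exp_minus_one_minus_times_exp_square_le[of s] s by (intro divide_right_mono) auto
  then have "c * (1 - s * (1 + v))\<^sup>2 \<le> c * (exp s * (1 - s * v)\<^sup>2)"
    using xy by (intro mult_left_mono)
  also have "\<dots> = x * (1 - s * v) * (y * (1 - s * v))"
    using xy(4) by (simp add: power2_eq_square)
  finally have "(cmod (G $ 1 $ 2))\<^sup>2 \<le> x * (1 - s * v) * (y * (1 - s * v))"
    by (simp add: G_def h_def norm_mult power_mult_distrib c_def del: of_real_diff of_real_mult of_real_add)
  then have "\<exists>S :: complex ^ 2 ^ 2. S ** conj_transpose S = G"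
    using xy(1) h0 by (intro cholesky_2[of _ "x * (1 - s * v)" "y * (1 - s * v)"])
      (auto simp: G_def h_def x_def y_def matA_diagonal matA_hermitian[of z 2 1])
  then obtain S :: "complex ^ 2 ^ 2" where S: "S ** conj_transpose S = G" ..
  have uu: "(\<Sum>k\<in>UNIV. u $ k * cnj (u $ k)) = complex_of_real s"
    using herm_dot_self[of u] by (simp add: herm_dot_def s_def)
  show ?thesis
  proof (rule complex_gaussian_law_exists_projection[OF _ _ R S, of E])
    fix i j
    show "E $ j $ i = cnj (E $ i $ j)"
      by (simp add: E_def)
    have "(\<Sum>k\<in>UNIV. E $ i $ k * E $ k $ j) =
        cnj (u $ i) * u $ j / (complex_of_real s)\<^sup>2 * (\<Sum>k\<in>UNIV. u $ k * cnj (u $ k))"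
      unfolding sum_distrib_left by (simp add: E_def power2_eq_square mult_ac)
    then show "(\<Sum>k\<in>UNIV. E $ i $ k * E $ k $ j) = E $ i $ j"
      unfolding uu using nonzero by (simp add: E_def power2_eq_square)
  next
    fix p q p' q'
    show "matLambda z $ (p, q) $ (p', q') =
      matA z $ p $ p' * ((if q = q' then 1 else 0) - E $ q $ q') + G $ p $ p' * E $ q $ q'"
      using nonzero unfolding matLambda_nth[OF z]
      by (simp add: G_def h_def E_def field_simps flip: u_def s_def v_def)
  qed
qed

section \<open>Evaluation in closed form\<close>

text \<open>The right side is what the Wick computation yields once \<open>|A_12|^2\<close> is
  cancelled: the product of traces, then the off-diagonal block, over the determinant. With
  \<open>g = exp t\<close> and \<open>E = g^2\<close> both sides are rational in \<open>g\<close>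
  and \<open>t\<close>, and clearing denominators proves equality.\<close>

lemma kappa_exp:
  assumes "r \<noteq> 0" "n > 0"
  defines "E \<equiv> exp (r\<^sup>2)"
  defines "v \<equiv> 1 / (E - 1)"
  shows "kappa n r = (E * (real n - v * r\<^sup>2)\<^sup>2 + (real n - 2 * (1 + v) * r\<^sup>2 + (1 + v)\<^sup>2 * r ^ 4))
      / (real n ^ 2 * (E - 1))"
proof -
  define t where "t = r\<^sup>2 / 2"
  define g where "g = exp t"
  have g: "g > 0" "g \<noteq> 0"
    by (simp_all add: g_def)
  have E: "E = g\<^sup>2"
    by (simp add: E_def g_def t_def exp_double[symmetric])
  have "t > 0"
    using assms by (simp add: t_def)
  then have g1: "g\<^sup>2 - 1 \<noteq> 0"
    by (simp add: g_def power2_eq_1_iff flip: exp_double)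
  have r: "r\<^sup>2 = 2 * t" "r ^ 4 = 4 * t\<^sup>2"
    by (simp_all add: t_def power2_eq_square power4_eq_xxxx)
  have sinh: "sinh t = (g\<^sup>2 - 1) / (2 * g)" and cosh: "cosh t = (g\<^sup>2 + 1) / (2 * g)"
    using g by (simp_all add: sinh_field_def cosh_field_def exp_minus g_def field_simps power2_eq_square)
  show ?thesis
    unfolding kappa_def Let_def t_def[symmetric]
    unfolding sinh cosh E v_def r
    using g g1 assms(2)
    by (simp add: divide_simps) (simp add: algebra_simps power2_eq_square power3_eq_cube power4_eq_xxxx)
qed

theorem mainTheorem6:
  fixes z1 z2 :: "complex ^ 'm::finite"
  assumes "z1 \<noteq> z2"
  shows "normalized_pair_correlation z1 z2 = complex_of_real (kappa CARD('m) (norm (z1 - z2)))"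
proof -
  define z :: "(complex ^ 'm) ^ 2" where "z = vector [z1, z2]"
  define u where "u = z1 - z2"
  define v where "v = 1 / (exp ((norm u)\<^sup>2) - 1)"
  \<comment> \<open>The product of the traces, the off-diagonal block and det A all carry this
    factor; what remains depends only on \<open>norm u\<close>.\<close>
  define c where "c = (cmod (matA z $ 1 $ 2))\<^sup>2"
  define n where "n = CARD('m)"
  have z: "z $ 1 \<noteq> z $ 2" "z $ 1 - z $ 2 = u"
    using assms by (simp_all add: z_def u_def)
  have u: "norm u \<noteq> 0" "exp ((norm u)\<^sup>2) \<noteq> 1"
    using assms by (simp_all add: u_def)
  have c: "c > 0"
    by (simp add: c_def matA_def)
  have n: "n > 0"
    by (simp add: n_def)
  have \<Lambda>: "matLambda z $ (p, q) $ (p', q') = matA z $ p $ p' *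
      ((if q = q' then 1 else 0) - complex_of_real (if p = p' then v else 1 + v) * cnj (u $ q) * u $ q')"
    for p q p' q'
    using matLambda_nth[OF z(1)] by (simp add: z v_def)
  have norm_u: "(\<Sum>q\<in>UNIV. (cmod (u $ q))\<^sup>2) = (norm u)\<^sup>2"
    by (simp add: norm_vec_def L2_set_def sum_nonneg)
  have cnj_u: "cnj (u $ q) * u $ q = complex_of_real ((cmod (u $ q))\<^sup>2)" for q
    by (simp only: complex_norm_square mult.commute)
  have trace: "(\<Sum>q\<in>UNIV. Re (matLambda z $ (p, q) $ (p, q))) =
      exp ((norm (z $ p))\<^sup>2) * (real n - v * (norm u)\<^sup>2)" for p
  proof -
    have "Re (matLambda z $ (p, q) $ (p, q)) = exp ((norm (z $ p))\<^sup>2) * (1 - v * (cmod (u $ q))\<^sup>2)" for q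
      unfolding \<Lambda> mult.assoc cnj_u matA_diagonal by simp
    then show ?thesis
      by (simp add: sum_distrib_left[symmetric] sum_subtractf norm_u n_def)
  qed
  \<comment> \<open>For \<open>q = q'\<close> the bracket in the entry is real and its square is
    expanded; for \<open>q \<noteq> q'\<close> only the rank-one term is left. Its contribution has
    the same form in both cases and factors in the double sum.\<close>
  have entry: "(cmod (matLambda z $ (1, q) $ (2, q')))\<^sup>2 =
      c * ((if q = q' then 1 - 2 * (1 + v) * (cmod (u $ q))\<^sup>2 else 0)
        + (1 + v)\<^sup>2 * (cmod (u $ q))\<^sup>2 * (cmod (u $ q'))\<^sup>2)" for q q'
  proof -
    have "(cmod (1 - complex_of_real (1 + v) * (cnj (u $ q) * u $ q)))\<^sup>2 =
        1 - 2 * (1 + v) * (cmod (u $ q))\<^sup>2 + (1 + v)\<^sup>2 * (cmod (u $ q))\<^sup>2 * (cmod (u $ q))\<^sup>2"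
    proof -
      have "1 - complex_of_real (1 + v) * (cnj (u $ q) * u $ q) =
          complex_of_real (1 - (1 + v) * (cmod (u $ q))\<^sup>2)"
        unfolding cnj_u by simp
      then show ?thesis
        by (simp only: norm_of_real) (simp add: power2_eq_square algebra_simps)
    qed
    moreover have "(cmod (complex_of_real (1 + v) * (cnj (u $ q) * u $ q')))\<^sup>2 =
        (1 + v)\<^sup>2 * (cmod (u $ q))\<^sup>2 * (cmod (u $ q'))\<^sup>2"
      unfolding norm_mult power_mult_distrib norm_of_real by simp
    ultimately show ?thesis
      unfolding \<Lambda> norm_mult[of "matA z $ 1 $ 2"] power_mult_distrib c_def[symmetric] mult.assoc[of "complex_of_real _"]
      by (cases "q = q'") (simp_all del: of_real_add)
  qed
  have cross: "(\<Sum>q\<in>UNIV. \<Sum>q'\<in>UNIV. (cmod (matLambda z $ (1, q) $ (2, q')))\<^sup>2) =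
      c * (real n - 2 * (1 + v) * (norm u)\<^sup>2 + (1 + v)\<^sup>2 * (norm u) ^ 4)"
  proof -
    have "(\<Sum>q\<in>UNIV. \<Sum>q'\<in>UNIV. (cmod (matLambda z $ (1, q) $ (2, q')))\<^sup>2) =
        c * ((\<Sum>q\<in>UNIV. 1 - 2 * (1 + v) * (cmod (u $ q))\<^sup>2) +
          (1 + v)\<^sup>2 * ((\<Sum>q\<in>UNIV. (cmod (u $ q))\<^sup>2) * (\<Sum>q\<in>UNIV. (cmod (u $ q))\<^sup>2)))"
      unfolding entry sum_distrib_left[symmetric] sum.distrib
      by (simp add: sum_product sum_distrib_left mult_ac)
    then show ?thesis
      unfolding norm_u sum_subtractf sum_distrib_left[symmetric] by (simp add: norm_u n_def power2_eq_square power4_eq_xxxx)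
  qed
  have "normalized_pair_correlation z1 z2 = complex_of_real ((pi / real n)\<^sup>2 *
      (1 / (pi\<^sup>2 * (c * (exp ((norm u)\<^sup>2) - 1))) *
        (exp ((norm (z $ 1))\<^sup>2) * (real n - v * (norm u)\<^sup>2) * (exp ((norm (z $ 2))\<^sup>2) * (real n - v * (norm u)\<^sup>2))
        + c * (real n - 2 * (1 + v) * (norm u)\<^sup>2 + (1 + v)\<^sup>2 * (norm u) ^ 4))))"
    unfolding normalized_pair_correlation_def pair_correlation_def Let_def z_def[symmetric] det_matA
      gaussian_expectation_prod_sum_squares[OF matLambda_gaussian_law_exists[OF z(1)]] trace cross
    unfolding z(2) c_def[symmetric] n_def[symmetric] by (simp only: of_real_mult of_real_divide of_real_1)
  \<comment> \<open>Rewriting \<open>A_11 A_22\<close> as \<open>c * exp ((norm u)^2)\<close>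
    exposes the common factor \<open>c\<close> of the numerator.\<close>
  also have "exp ((norm (z $ 1))\<^sup>2) * (real n - v * (norm u)\<^sup>2) * (exp ((norm (z $ 2))\<^sup>2) * (real n - v * (norm u)\<^sup>2))
      = c * (exp ((norm u)\<^sup>2) * (real n - v * (norm u)\<^sup>2)\<^sup>2)"
    using norm_matA_mult_exp[of z] by (simp add: z(2) c_def power2_eq_square mult_ac)
  also have "(pi / real n)\<^sup>2 * (1 / (pi\<^sup>2 * (c * (exp ((norm u)\<^sup>2) - 1))) *
        (c * (exp ((norm u)\<^sup>2) * (real n - v * (norm u)\<^sup>2)\<^sup>2)
        + c * (real n - 2 * (1 + v) * (norm u)\<^sup>2 + (1 + v)\<^sup>2 * (norm u) ^ 4))) = kappa n (norm u)"
    unfolding kappa_exp[OF u(1) n] v_def[symmetric] distrib_left[symmetric]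
    using c n by (simp add: power_divide)
  finally show ?thesis
    by (simp add: n_def u_def)
qed

end
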